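(* Consider any instance of the partitioned Kuramoto model described in the context. Then: 1. For each $\tau\in\{1,\dots,m\}$, the monomial $z^{\boldsymbol\mu_\tau}=\prod_{j\in\mathcal M_\tau}z_j^{\mu_{\tau j}}$ (i.e. $\exp(i\sum_{j\in\mathcal M_\tau}\mu_{\tau j}\theta_j)$ in terms of the phases) is an eigenfunction of the Koopman generator $\mathcal K$ with eigenvalue $i\boldsymbol\mu_\tau^\top\boldsymbol\omega=i\sum_{j\in\mathcal M_\tau}\mu_{\tau j}\omega_j$. 2. For each $\gamma\in\{1,\dots,c\}$ and all pairwise distinct $a,b,c',d\in\mathcal C_\gamma$, the cross-ratio $$c_{abc'd}(\boldsymbol z)=\frac{(z_{c'}-z_a)(z_d-z_b)}{(z_{c'}-z_b)(z_d-z_a)}$$ is a constant of motion of the model. 3. The model has $q=(m-1)+\sum_{\gamma=1}^c(n_\gamma-3)$ functionally independent (time-independent) constants of motion, of which $m-1$ are monomials in $(z_j)_{j\in\mathcal M_1\cup\cdots\cup\mathcal M_m}$ (with real exponents) and, for each $\gamma$, $n_\gamma-3$ are cross-ratios of the variables $(z_j)_{j\in\mathcal C_\gamma}$.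
   Context: Notation: the bar is complex conjugation, $\mathcal V=\{1,\dots,N\}$. Partitioned Kuramoto model. Let $m\ge 1$, $c\ge 0$, $p\ge0$ be integers (empty sums are zero). The vertex set $\mathcal V$ is partitioned into $\mathcal M_1,\dots,\mathcal M_m$ with $|\mathcal M_\tau|=d_\tau\geq 1$, $\mathcal C_1,\dots,\mathcal C_c$ with $|\mathcal C_\gamma|=n_\gamma\ge4$, and $\mathcal P$ with $|\mathcal P|=p$. The Kuramoto equations are $$\dot\theta_j=\omega_j+\sum_{k\in\mathcal V}W_{jk}\sin(\theta_k-\theta_j-\alpha_{jk}),\qquad j\in\mathcal V,$$ with real $\omega_j,W_{jk},\alpha_{jk}$ and $W_{jj}=\alpha_{jj}=0$ for all $j$. With $z_j=e^{i\theta_j}$ they read $\dot z_j=\sum_kA_{jk}z_k-\big(\sum_k\overline{A_{jk}}\,\overline{z_k}\big)z_j^2$, where $A_{jk}=\tfrac12W_{jk}e^{-i\alpha_{jk}}$ for $j\ne k$ and $A_{jj}=\tfrac i2\omega_j$. The parameters have the following structure. (i) Rows $j\in\mathcal M_\tau$: there are nonzero reals $\mu_{\tau j}$ ($j\in\mathcal M_\tau$), reals $S_{jk}=S_{kj}$ and reals $\kappa_{jk}=-\kappa_{kj}$ with $|\kappa_{jk}|<\pi/2$ ($j,k\in\mathcal M_\tau$), with $S_{jj}=0$, such that $W_{jk}=S_{jk}/\mu_{\tau j}$ and $\alpha_{jk}=\kappa_{jk}$ for $k\in\mathcal M_\tau$, and $W_{jk}=0$ for $k\notin\mathcal M_\tau$.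 The $\omega_j$ are arbitrary reals. (ii) Rows $j\in\mathcal C_\gamma$: there are reals $C_{k\gamma}$ and $\chi_{k\gamma}$ with $|\chi_{k\gamma}|<\pi/2$ ($k\in\mathcal V$) such that $W_{jk}=C_{k\gamma}$ and $\alpha_{jk}=\chi_{k\gamma}$ for all $k\ne j$. Put $\mathcal A_{\gamma k}=\tfrac12C_{k\gamma}e^{-i\chi_{k\gamma}}$ for all $k\in\mathcal V$. For a fixed reference index $\ell_\gamma\in\mathcal C_\gamma$, $\omega_{\ell_\gamma}$ is an arbitrary real and $\omega_j=\omega_{\ell_\gamma}+2\,\mathrm{Im}(\mathcal A_{\gamma j}-\mathcal A_{\gamma\ell_\gamma})$ for $j\in\mathcal C_\gamma$. (iii) Rows $j\in\mathcal P$: $W_{jk},\alpha_{jk}$ ($k\neq j$) and $\omega_j$ are arbitrary reals. The entries may be random in applications; the statement concerns every fixed instance. The vector $\boldsymbol\mu_\tau\in\mathbb R^N$ has $j$-th entry $\mu_{\tau j}$ for $j\in\mathcal M_\tau$ and $0$ otherwise; $\boldsymbol\omega=(\omega_1,\dots,\omega_N)$. The Koopman generator is the derivation along the flow, $\mathcal K=\sum_j\dot z_j\,\partial/\partial z_j$ with $\dot z_j$ replaced by the right-hand side above (on $|z_j|=1$, $\bar z_j=1/z_j$); equivalently, in phase coordinates $\mathcal K=\sum_j\dot\theta_j\,\partial/\partial\theta_j$. A constant of motion is a function $f$ of the state with $\mathcal Kf=0$ on its domain; monomials with non-integer exponents are regarded as functions of the phases $\boldsymbol\theta\in\mathbb R^N$,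 and cross-ratios are considered where the denominators are nonzero. Functions are functionally independent if their differentials (with respect to $\boldsymbol\theta$) are linearly independent on a dense open subset of their common domain. *)

theory Defs
  imports "HOL-Analysis.Analysis"
begin

text \<open>
  The vertex set is the finite type \<open>'n\<close>, so a state, i.e. a vector of phases, is a \<open>\<theta> :: real ^ 'n\<close>.
  All functions of the state are total functions of the phases; functions which the paper considers
  only where some denominator is nonzero come with an explicit domain.
\<close>

definition kuramoto_field ::
  "real ^ 'n ^ 'n \<Rightarrow> real ^ 'n ^ 'n \<Rightarrow> real ^ 'n \<Rightarrow> real ^ 'n \<Rightarrow> real ^ 'n::finite"
  where "kuramoto_field W \<alpha> \<omega> \<theta> =
    (\<chi> j. \<omega> $ j + (\<Sum>k\<in>UNIV. W $ j $ k * sin (\<theta> $ k - \<theta> $ j - \<alpha> $ j $ k)))"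

definition partial_deriv :: "'n \<Rightarrow> (real ^ 'n \<Rightarrow> complex) \<Rightarrow> real ^ 'n::finite \<Rightarrow> complex"
  where "partial_deriv j f \<theta> = vector_derivative (\<lambda>t. f (\<theta> + t *\<^sub>R axis j 1)) (at 0)"

definition koopman ::
  "(real ^ 'n \<Rightarrow> real ^ 'n) \<Rightarrow> (real ^ 'n \<Rightarrow> complex) \<Rightarrow> real ^ 'n::finite \<Rightarrow> complex"
  where "koopman F f \<theta> = (\<Sum>j\<in>UNIV. complex_of_real (F \<theta> $ j) * partial_deriv j f \<theta>)"

definition koopman_eigenfunction ::
  "(real ^ 'n \<Rightarrow> real ^ 'n) \<Rightarrow> complex \<Rightarrow> (real ^ 'n::finite \<Rightarrow> complex) \<Rightarrow> bool"
  where "koopman_eigenfunction F lam f \<longleftrightarrow>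
    (\<exists>\<theta>. f \<theta> \<noteq> 0) \<and> (\<forall>\<theta>. f differentiable (at \<theta>) \<and> koopman F f \<theta> = lam * f \<theta>)"

definition constant_of_motion ::
  "(real ^ 'n \<Rightarrow> real ^ 'n) \<Rightarrow> (real ^ 'n) set \<Rightarrow> (real ^ 'n::finite \<Rightarrow> complex) \<Rightarrow> bool"
  where "constant_of_motion F D f \<longleftrightarrow>
    open D \<and> (\<forall>\<theta>\<in>D. f differentiable (at \<theta>) \<and> koopman F f \<theta> = 0)"

text \<open>
  The functions are complex-valued, so linear independence of the differentials
  \<open>(partial_deriv j (f i) \<theta>)\<^sub>j\<close> is taken over the complex numbers (which implies independence over
  the reals). It is independence of an indexed family: repeated members are dependent.
\<close>

definition functionally_independent ::
  "'i set \<Rightarrow> ('i \<Rightarrow> (real ^ 'n) set) \<Rightarrow> ('i \<Rightarrow> real ^ 'n::finite \<Rightarrow> complex) \<Rightarrow> bool"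
  where "functionally_independent I D f \<longleftrightarrow>
    (\<exists>U. open U \<and> U \<subseteq> (\<Inter>i\<in>I. D i) \<and> (\<Inter>i\<in>I. D i) \<subseteq> closure U \<and>
      (\<forall>\<theta>\<in>U. (\<forall>i\<in>I. f i differentiable (at \<theta>)) \<and>
        (\<forall>a :: 'i \<Rightarrow> complex.
          (\<forall>j. (\<Sum>i\<in>I. a i * partial_deriv j (f i) \<theta>) = 0) \<longrightarrow> (\<forall>i\<in>I. a i = 0))))"

definition monomial :: "real ^ 'n \<Rightarrow> real ^ 'n::finite \<Rightarrow> complex"
  where "monomial \<nu> \<theta> = exp (\<i> * complex_of_real (\<Sum>j\<in>UNIV. \<nu> $ j * \<theta> $ j))"

definition phasor :: "real ^ 'n \<Rightarrow> 'n::finite \<Rightarrow> complex"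
  where "phasor \<theta> j = exp (\<i> * complex_of_real (\<theta> $ j))"

definition cross_ratio :: "'n \<Rightarrow> 'n \<Rightarrow> 'n \<Rightarrow> 'n \<Rightarrow> real ^ 'n::finite \<Rightarrow> complex"
  where "cross_ratio a b c d \<theta> =
    ((phasor \<theta> c - phasor \<theta> a) * (phasor \<theta> d - phasor \<theta> b)) /
    ((phasor \<theta> c - phasor \<theta> b) * (phasor \<theta> d - phasor \<theta> a))"

definition cross_ratio_domain :: "'n \<Rightarrow> 'n \<Rightarrow> 'n \<Rightarrow> 'n \<Rightarrow> (real ^ 'n::finite) set"
  where "cross_ratio_domain a b c d =
    {\<theta>. (phasor \<theta> c - phasor \<theta> b) * (phasor \<theta> d - phasor \<theta> a) \<noteq> 0}"

definition mu_vec :: "(nat \<Rightarrow> 'n set) \<Rightarrow> (nat \<Rightarrow> 'n \<Rightarrow> real) \<Rightarrow> nat \<Rightarrow> real ^ 'n::finite"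
  where "mu_vec \<M> \<mu> \<tau> = (\<chi> j. if j \<in> \<M> \<tau> then \<mu> \<tau> j else 0)"

definition common_coeff :: "('n \<Rightarrow> nat \<Rightarrow> real) \<Rightarrow> ('n \<Rightarrow> nat \<Rightarrow> real) \<Rightarrow> nat \<Rightarrow> 'n \<Rightarrow> complex"
  where "common_coeff C ph \<gamma> k = 1 / 2 * complex_of_real (C k \<gamma>) * exp (- \<i> * complex_of_real (ph k \<gamma>))"

text \<open>
  In the paper's notation, \<open>ph k \<gamma>\<close> is $\chi_{k\gamma}$, \<open>ell \<gamma>\<close> is the reference index
  $\ell_\gamma$, and \<open>common_coeff C ph \<gamma> k\<close> is $\mathcal A_{\gamma k}$. Rows in \<open>\<P>\<close> carry no
  assumption apart from the vanishing diagonal.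
\<close>

locale partitioned_kuramoto =
  fixes m c :: nat
    and \<M> \<C> :: "nat \<Rightarrow> 'n::finite set"
    and \<P> :: "'n set"
    and W \<alpha> :: "real ^ 'n ^ 'n"
    and \<omega> :: "real ^ 'n"
    and \<mu> :: "nat \<Rightarrow> 'n \<Rightarrow> real"
    and S \<kappa> :: "'n \<Rightarrow> 'n \<Rightarrow> real"
    and C ph :: "'n \<Rightarrow> nat \<Rightarrow> real"
    and ell :: "nat \<Rightarrow> 'n"
  assumes m_pos: "m \<ge> 1"
    and M_nonempty: "\<And>\<tau>. \<tau> \<in> {1..m} \<Longrightarrow> \<M> \<tau> \<noteq> {}"
    and C_card: "\<And>\<gamma>. \<gamma> \<in> {1..c} \<Longrightarrow> card (\<C> \<gamma>) \<ge> 4"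
    and M_disjoint: "disjoint_family_on \<M> {1..m}"
    and C_disjoint: "disjoint_family_on \<C> {1..c}"
    and MC_disjoint: "(\<Union>\<tau>\<in>{1..m}. \<M> \<tau>) \<inter> (\<Union>\<gamma>\<in>{1..c}. \<C> \<gamma>) = {}"
    and MP_disjoint: "(\<Union>\<tau>\<in>{1..m}. \<M> \<tau>) \<inter> \<P> = {}"
    and CP_disjoint: "(\<Union>\<gamma>\<in>{1..c}. \<C> \<gamma>) \<inter> \<P> = {}"
    and cover: "(\<Union>\<tau>\<in>{1..m}. \<M> \<tau>) \<union> (\<Union>\<gamma>\<in>{1..c}. \<C> \<gamma>) \<union> \<P> = UNIV"
    and W_diag: "\<And>j. W $ j $ j = 0"
    and alpha_diag: "\<And>j. \<alpha> $ j $ j = 0"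
    and mu_nonzero: "\<And>\<tau> j. \<lbrakk>\<tau> \<in> {1..m}; j \<in> \<M> \<tau>\<rbrakk> \<Longrightarrow> \<mu> \<tau> j \<noteq> 0"
    and S_sym: "\<And>\<tau> j k. \<lbrakk>\<tau> \<in> {1..m}; j \<in> \<M> \<tau>; k \<in> \<M> \<tau>\<rbrakk> \<Longrightarrow> S j k = S k j"
    and S_diag: "\<And>\<tau> j. \<lbrakk>\<tau> \<in> {1..m}; j \<in> \<M> \<tau>\<rbrakk> \<Longrightarrow> S j j = 0"
    and kappa_antisym: "\<And>\<tau> j k. \<lbrakk>\<tau> \<in> {1..m}; j \<in> \<M> \<tau>; k \<in> \<M> \<tau>\<rbrakk> \<Longrightarrow> \<kappa> j k = - \<kappa> k j"
    and kappa_bound: "\<And>\<tau> j k. \<lbrakk>\<tau> \<in> {1..m}; j \<in> \<M> \<tau>; k \<in> \<M> \<tau>\<rbrakk> \<Longrightarrow> \<bar>\<kappa> j k\<bar> < pi / 2"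
    and W_M: "\<And>\<tau> j k. \<lbrakk>\<tau> \<in> {1..m}; j \<in> \<M> \<tau>; k \<in> \<M> \<tau>\<rbrakk> \<Longrightarrow> W $ j $ k = S j k / \<mu> \<tau> j"
    and alpha_M: "\<And>\<tau> j k. \<lbrakk>\<tau> \<in> {1..m}; j \<in> \<M> \<tau>; k \<in> \<M> \<tau>\<rbrakk> \<Longrightarrow> \<alpha> $ j $ k = \<kappa> j k"
    and W_M_out: "\<And>\<tau> j k. \<lbrakk>\<tau> \<in> {1..m}; j \<in> \<M> \<tau>; k \<notin> \<M> \<tau>\<rbrakk> \<Longrightarrow> W $ j $ k = 0"
    and ph_bound: "\<And>\<gamma> k. \<gamma> \<in> {1..c} \<Longrightarrow> \<bar>ph k \<gamma>\<bar> < pi / 2"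
    and W_C: "\<And>\<gamma> j k. \<lbrakk>\<gamma> \<in> {1..c}; j \<in> \<C> \<gamma>; k \<noteq> j\<rbrakk> \<Longrightarrow> W $ j $ k = C k \<gamma>"
    and alpha_C: "\<And>\<gamma> j k. \<lbrakk>\<gamma> \<in> {1..c}; j \<in> \<C> \<gamma>; k \<noteq> j\<rbrakk> \<Longrightarrow> \<alpha> $ j $ k = ph k \<gamma>"
    and ell_in: "\<And>\<gamma>. \<gamma> \<in> {1..c} \<Longrightarrow> ell \<gamma> \<in> \<C> \<gamma>"
    and omega_C: "\<And>\<gamma> j. \<lbrakk>\<gamma> \<in> {1..c}; j \<in> \<C> \<gamma>\<rbrakk> \<Longrightarrow>
      \<omega> $ j = \<omega> $ ell \<gamma> + 2 * Im (common_coeff C ph \<gamma> j - common_coeff C ph \<gamma> (ell \<gamma>))"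

end

theory Submission
  imports Defs
begin

text \<open>
  On a block \<open>\<C> \<gamma>\<close> all phasors solve one and the same Riccati equation
  \<open>z' = p + q z + r z\<^sup>2\<close>, so that numerator and denominator of a cross-ratio have the same logarithmic
  derivative. On a block \<open>\<M> \<tau>\<close> the interaction terms of \<open>\<mu>\<^sub>\<tau> \<bullet> \<theta>'\<close> cancel in pairs, and suitable
  real combinations of the \<open>\<mu>\<^sub>\<tau>\<close> are orthogonal to \<open>\<omega>\<close>. For independence, take on each \<open>\<C> \<gamma>\<close>
  the cross-ratios of three fixed base points with a fourth, varying point. Every chosen constant of
  motion then has a vertex whose phase enters it but none of the others: the Jacobian restricted to
  these vertices is diagonal, with nonzero entries wherever all phasors are distinct.
\<close>

section \<open>Total derivatives, the Koopman generator, and a diagonal criterion for functional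
  independence\<close>

lemma partial_deriv_eq:
  assumes "(f has_derivative f') (at \<theta>)"
  shows "partial_deriv j f \<theta> = f' (axis j 1)"
proof -
  interpret bounded_linear f' using assms by (rule has_derivative_bounded_linear)
  have "((\<lambda>t. \<theta> + t *\<^sub>R axis j 1) has_derivative (\<lambda>t. t *\<^sub>R axis j 1)) (at (0::real))"
    by (auto intro!: derivative_eq_intros)
  moreover have "(f has_derivative f') (at (\<theta> + 0 *\<^sub>R axis j 1))"
    using assms by simp
  ultimately have "((\<lambda>t. f (\<theta> + t *\<^sub>R axis j 1)) has_derivative (\<lambda>t. f' (t *\<^sub>R axis j 1))) (at 0)"
    by (rule has_derivative_compose)
  then have "((\<lambda>t. f (\<theta> + t *\<^sub>R axis j 1)) has_vector_derivative f' (axis j 1)) (at 0)"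
    by (simp add: has_vector_derivative_def scaleR)
  then show ?thesis
    unfolding partial_deriv_def by (rule vector_derivative_at)
qed

text \<open>By linearity of the total derivative, the sum of partial derivatives weighted by the
  components of \<open>F \<theta>\<close> is the derivative in the direction
  \<open>F \<theta>\<close>. Hence only total derivatives need computing below.\<close>

lemma koopman_eq:
  assumes "(f has_derivative f') (at \<theta>)"
  shows "koopman F f \<theta> = f' (F \<theta>)"
proof -
  interpret bounded_linear f' using assms by (rule has_derivative_bounded_linear)
  have "F \<theta> = (\<Sum>j\<in>UNIV. F \<theta> $ j *\<^sub>R axis j 1)"
    using basis_expansion[of "F \<theta>"] by (simp add: scalar_mult_eq_scaleR)
  then have "f' (F \<theta>) = (\<Sum>j\<in>UNIV. F \<theta> $ j *\<^sub>R f' (axis j 1))"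
    by (metis (no_types, lifting) sum scaleR sum.cong)
  then show ?thesis
    by (simp add: koopman_def partial_deriv_eq[OF assms] scaleR_conv_of_real)
qed

text \<open>Each index \<open>i\<close> has a coordinate \<open>e i\<close> on which, among the
  chosen functions, only \<open>f i\<close> depends to first order. Coordinate \<open>e i\<close> of
  a vanishing combination therefore contains the single term with \<open>a i\<close>, and its factor
  is nonzero. Density of \<open>U\<close> in the whole space covers every common domain.\<close>

lemma functionally_independent_diagonal:
  assumes "finite I" "open U" "closure U = UNIV" "\<And>i. i \<in> I \<Longrightarrow> U \<subseteq> D i"
    and "\<And>i \<theta>. i \<in> I \<Longrightarrow> \<theta> \<in> U \<Longrightarrow> f i differentiable (at \<theta>)"
    and diag: "\<And>i \<theta>. i \<in> I \<Longrightarrow> \<theta> \<in> U \<Longrightarrow> partial_deriv (e i) (f i) \<theta> \<noteq> 0"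
    and off: "\<And>i k \<theta>. i \<in> I \<Longrightarrow> k \<in> I \<Longrightarrow> i \<noteq> k \<Longrightarrow> \<theta> \<in> U \<Longrightarrow> partial_deriv (e i) (f k) \<theta> = 0"
  shows "functionally_independent I D f"
  unfolding functionally_independent_def
proof (intro exI[of _ U] conjI ballI allI impI)
  fix \<theta> and a :: "'a \<Rightarrow> complex" and i
  assume \<theta>: "\<theta> \<in> U" and i: "i \<in> I"
    and sum0: "\<forall>j. (\<Sum>i\<in>I. a i * partial_deriv j (f i) \<theta>) = 0"
  have "(\<Sum>k\<in>I. a k * partial_deriv (e i) (f k) \<theta>)
      = (\<Sum>k\<in>I. if k = i then a i * partial_deriv (e i) (f i) \<theta> else 0)"
    by (rule sum.cong) (auto simp: off[OF i _ _ \<theta>])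
  also have "\<dots> = a i * partial_deriv (e i) (f i) \<theta>"
    using \<open>finite I\<close> i by simp
  finally show "a i = 0"
    using sum0 diag[OF i \<theta>] by simp
qed (use assms in auto)

section \<open>Exponentials of imaginary phases and derivatives of monomials\<close>

lemma has_derivative_exp_i_times_of_real:
  fixes u :: "'a::real_normed_vector \<Rightarrow> real"
  assumes "(u has_derivative u') (at x)"
  shows "((\<lambda>x. exp (\<i> * complex_of_real (u x))) has_derivative
    (\<lambda>h. \<i> * complex_of_real (u' h) * exp (\<i> * complex_of_real (u x)))) (at x)"
proof -
  have "((\<lambda>x. \<i> * complex_of_real (u x)) has_derivative (\<lambda>h. \<i> * complex_of_real (u' h))) (at x)"
    by (intro has_derivative_mult_right has_derivative_of_real assms)
  from has_derivative_compose[OF this DERIV_exp[unfolded has_field_derivative_def]]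
  show ?thesis
    by (simp add: mult.commute)
qed

lemma monomial_has_derivative:
  "(monomial \<nu> has_derivative (\<lambda>h. \<i> * complex_of_real (\<nu> \<bullet> h) * monomial \<nu> \<theta>)) (at \<theta>)"
proof -
  have "monomial \<nu> = (\<lambda>\<theta>. exp (\<i> * complex_of_real (\<nu> \<bullet> \<theta>)))"
    by (simp add: fun_eq_iff monomial_def inner_vec_def)
  then show ?thesis
    by (simp only:) (intro has_derivative_exp_i_times_of_real has_derivative_inner_right has_derivative_ident)
qed

lemma monomial_nonzero: "monomial \<nu> \<theta> \<noteq> 0"
  by (simp add: monomial_def)

lemma koopman_monomial:
  "koopman F (monomial \<nu>) \<theta> = \<i> * complex_of_real (\<nu> \<bullet> F \<theta>) * monomial \<nu> \<theta>"
  by (rule koopman_eq[OF monomial_has_derivative])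

lemma partial_deriv_monomial:
  "partial_deriv j (monomial \<nu>) \<theta> = \<i> * complex_of_real (\<nu> $ j) * monomial \<nu> \<theta>"
  by (simp add: partial_deriv_eq[OF monomial_has_derivative] inner_axis)

lemma monomial_differentiable: "monomial \<nu> differentiable (at \<theta>)"
  using monomial_has_derivative differentiable_def by blast

section \<open>Derivatives of phasors and cross-ratios\<close>

lemma phasor_nonzero: "phasor \<theta> j \<noteq> 0"
  by (simp add: phasor_def)

lemma continuous_on_phasor: "continuous_on A (\<lambda>\<theta>. phasor \<theta> j)"
  unfolding phasor_def by (intro continuous_intros)

lemma phasor_has_derivative:
  "((\<lambda>\<theta>. phasor \<theta> j) has_derivative (\<lambda>h. \<i> * complex_of_real (h $ j) * phasor \<theta> j)) (at \<theta>)"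
  unfolding phasor_def
  by (intro has_derivative_exp_i_times_of_real bounded_linear_imp_has_derivative bounded_linear_vec_nth)

text \<open>This is the quotient rule, with \<open>v h j\<close> the derivative of the
  \<open>j\<close>-th phasor in direction \<open>h\<close>. The velocities are left unexpanded, so
  that along the flow the Riccati equation can be substituted for them.\<close>

lemma cross_ratio_has_derivative:
  fixes a b c d :: "'n::finite" and \<theta> :: "real ^ 'n"
  defines "z \<equiv> phasor \<theta>" and "v \<equiv> \<lambda>h j. \<i> * complex_of_real (h $ j) * phasor \<theta> j"
  assumes "\<theta> \<in> cross_ratio_domain a b c d"
  shows "(cross_ratio a b c d has_derivative
    (\<lambda>h. (((v h c - v h a) * (z d - z b) + (z c - z a) * (v h d - v h b)) * ((z c - z b) * (z d - z a))
        - (z c - z a) * (z d - z b) * ((v h c - v h b) * (z d - z a) + (z c - z b) * (v h d - v h a)))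
      / ((z c - z b) * (z d - z a))\<^sup>2)) (at \<theta>)"
proof -
  have nz: "(phasor \<theta> c - phasor \<theta> b) * (phasor \<theta> d - phasor \<theta> a) \<noteq> 0"
    using assms by (simp add: cross_ratio_domain_def)
  have N: "((\<lambda>\<theta>. (phasor \<theta> c - phasor \<theta> a) * (phasor \<theta> d - phasor \<theta> b)) has_derivative
      (\<lambda>h. (v h c - v h a) * (z d - z b) + (z c - z a) * (v h d - v h b))) (at \<theta>)"
    unfolding z_def v_def
    by (rule has_derivative_eq_rhs, (rule has_derivative_mult has_derivative_diff phasor_has_derivative)+)
      (simp add: fun_eq_iff algebra_simps)
  have Q: "((\<lambda>\<theta>. (phasor \<theta> c - phasor \<theta> b) * (phasor \<theta> d - phasor \<theta> a)) has_derivative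
      (\<lambda>h. (v h c - v h b) * (z d - z a) + (z c - z b) * (v h d - v h a))) (at \<theta>)"
    unfolding z_def v_def
    by (rule has_derivative_eq_rhs, (rule has_derivative_mult has_derivative_diff phasor_has_derivative)+)
      (simp add: fun_eq_iff algebra_simps)
  show ?thesis
    unfolding cross_ratio_def[abs_def]
    by (rule has_derivative_eq_rhs[OF has_derivative_divide'[OF N Q nz]])
      (simp add: fun_eq_iff power2_eq_square z_def)
qed

lemma cross_ratio_differentiable:
  "\<theta> \<in> cross_ratio_domain a b c d \<Longrightarrow> cross_ratio a b c d differentiable (at \<theta>)"
  using cross_ratio_has_derivative differentiable_def by blast

lemma open_cross_ratio_domain: "open (cross_ratio_domain a b c d)"
  unfolding cross_ratio_domain_def
  by (intro open_Collect_neq continuous_intros continuous_on_phasor)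

text \<open>If \<open>x\<close> and \<open>y\<close> solve the same equation
  \<open>z' = p + q z + r z^2\<close>, then \<open>(x - y)' = (x - y) (q + r (x + y))\<close>.
  Numerator and denominator of the cross-ratio both have logarithmic derivative
  \<open>2 q + r (z_a + z_b + z_c + z_d)\<close>, so their quotient has derivative zero.\<close>

lemma koopman_cross_ratio_Riccati:
  assumes dom: "\<theta> \<in> cross_ratio_domain a b c d"
    and Riccati: "\<And>j. j \<in> {a, b, c, d} \<Longrightarrow>
      \<i> * complex_of_real (F \<theta> $ j) * phasor \<theta> j = p + q * phasor \<theta> j + r * (phasor \<theta> j)\<^sup>2"
  shows "koopman F (cross_ratio a b c d) \<theta> = 0"
proof -
  \<comment> \<open>The product rule for two differences of Riccati solutions. It is used twice: for
    the pairs \<open>c, a\<close> and \<open>d, b\<close> of the numerator, then for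
    \<open>c, b\<close> and \<open>d, a\<close> of the denominator.\<close>
  have eq: "((va - va') * s + t * (vb - vb')) = t * s * (2 * q + r * (xa + xa' + xb + xb'))"
    if "va = p + q * xa + r * xa\<^sup>2" "va' = p + q * xa' + r * xa'\<^sup>2"
      "vb = p + q * xb + r * xb\<^sup>2" "vb' = p + q * xb' + r * xb'\<^sup>2" "t = xa - xa'" "s = xb - xb'"
    for va va' vb vb' xa xa' xb xb' s t :: complex
    unfolding that by (simp add: power2_eq_square algebra_simps)
  note R = Riccati[of a] Riccati[of b] Riccati[of c] Riccati[of d]
  show ?thesis
    unfolding koopman_eq[OF cross_ratio_has_derivative[OF dom]]
    by (subst eq[OF R(3) R(1) R(4) R(2) refl refl], simp_all)
      (subst eq[OF R(3) R(2) R(4) R(1) refl refl], simp_all add: algebra_simps)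
qed

lemma partial_deriv_cross_ratio_other:
  assumes "\<theta> \<in> cross_ratio_domain a b c d" "j \<notin> {a, b, c, d}"
  shows "partial_deriv j (cross_ratio a b c d) \<theta> = 0"
proof -
  have "axis j (1::real) $ a = 0" "axis j (1::real) $ b = 0" "axis j (1::real) $ c = 0" "axis j (1::real) $ d = 0"
    using assms(2) by (auto simp: axis_def)
  then show ?thesis
    by (simp add: partial_deriv_eq[OF cross_ratio_has_derivative[OF assms(1)]])
qed

section \<open>The open dense set of states with pairwise distinct phasors\<close>

definition distinct_phasors :: "(real ^ 'n::finite) set"
  where "distinct_phasors = {\<theta>. inj (phasor \<theta>)}"

lemma distinct_phasors_subset_cross_ratio_domain:
  "distinct [a, b, c, d] \<Longrightarrow> distinct_phasors \<subseteq> cross_ratio_domain a b c d"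
  by (auto simp: distinct_phasors_def cross_ratio_domain_def inj_def)

text \<open>As a function of \<open>z d\<close> alone the cross-ratio is a Moebius transformation.
  It is nondegenerate because the other three points are distinct, so its derivative vanishes
  nowhere; the chain rule adds only the nonzero factor \<open>\<i> * z d\<close>.\<close>

lemma partial_deriv_cross_ratio_last:
  assumes "\<theta> \<in> distinct_phasors" "distinct [a, b, c, d]"
  shows "partial_deriv d (cross_ratio a b c d) \<theta> \<noteq> 0"
proof -
  define z where "z = phasor \<theta>"
  have dom: "\<theta> \<in> cross_ratio_domain a b c d"
    using assms distinct_phasors_subset_cross_ratio_domain by blast
  have ne: "z a \<noteq> z b" "z c \<noteq> z a" "z c \<noteq> z b" "z d \<noteq> z a" "z d \<noteq> 0"
    using assms by (auto simp: z_def distinct_phasors_def inj_eq phasor_nonzero)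
  have "partial_deriv d (cross_ratio a b c d) \<theta> =
      (\<i> * z d * (z c - z a) * (z c - z b) * (z b - z a)) / ((z c - z b) * (z d - z a))\<^sup>2"
    using assms(2)
    by (simp add: partial_deriv_eq[OF cross_ratio_has_derivative[OF dom]] axis_def z_def[symmetric]
        algebra_simps)
  then show ?thesis
    using ne by simp
qed

lemma distinct_phasors_eq:
  "distinct_phasors = (\<Inter>(j, k)\<in>{(j, k). j \<noteq> k}. {\<theta>. phasor \<theta> j \<noteq> phasor \<theta> k})"
  by (auto simp: distinct_phasors_def inj_def)

lemma open_phasor_neq: "open {\<theta>. phasor \<theta> j \<noteq> phasor \<theta> k}"
  by (intro open_Collect_neq continuous_on_phasor)

lemma open_distinct_phasors: "open (distinct_phasors :: (real ^ 'n::finite) set)"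
  unfolding distinct_phasors_eq by (rule open_INT) (auto simp: open_phasor_neq)

lemma closure_phasor_neq:
  fixes j k :: "'n::finite"
  assumes "j \<noteq> k"
  shows "closure {\<theta>. phasor \<theta> j \<noteq> phasor \<theta> k} = UNIV"
proof (intro set_eqI iffI UNIV_I, unfold closure_approachable, intro allI impI)
  fix \<theta> :: "real ^ 'n" and e :: real
  assume "e > 0"
  show "\<exists>\<theta>'\<in>{\<theta>. phasor \<theta> j \<noteq> phasor \<theta> k}. dist \<theta>' \<theta> < e"
  proof (cases "phasor \<theta> j = phasor \<theta> k")
    case True
    \<comment> \<open>A coincidence of two phasors is broken by rotating one of them by
      \<open>t\<close>. The bound 1 keeps \<open>t\<close> below \<open>pi\<close>, so that
      \<open>sin t\<close> is positive, and \<open>e / 2\<close> makes the distance strictly less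
      than \<open>e\<close>.\<close>
    define t where "t = min (e / 2) 1"
    have t: "0 < t" "t < e" "t \<le> 1"
      using \<open>e > 0\<close> by (auto simp: t_def)
    define \<theta>' where "\<theta>' = \<theta> + t *\<^sub>R axis j 1"
    have "exp (\<i> * complex_of_real t) \<noteq> 1"
    proof
      assume "exp (\<i> * complex_of_real t) = 1"
      then have "sin t = 0"
        using Im_exp[of "\<i> * complex_of_real t"] by simp
      then show False
        using sin_gt_zero[of t] t pi_gt3 by simp
    qed
    moreover have "phasor \<theta>' j = phasor \<theta> j * exp (\<i> * complex_of_real t)" "phasor \<theta>' k = phasor \<theta> k"
      using assms by (simp_all add: phasor_def \<theta>'_def axis_def algebra_simps exp_add)
    ultimately have "phasor \<theta>' j \<noteq> phasor \<theta>' k"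
      using True phasor_nonzero[of \<theta> k] by simp
    moreover have "dist \<theta>' \<theta> < e"
      using t by (simp add: \<theta>'_def dist_norm norm_axis_1)
    ultimately show ?thesis
      by blast
  qed (use \<open>e > 0\<close> in auto)
qed

text \<open>There are only finitely many pairs of vertices, and each one excludes the complement of
  an open dense set, so the Baire category theorem applies.\<close>

lemma closure_distinct_phasors: "closure distinct_phasors = (UNIV :: (real ^ 'n::finite) set)"
proof -
  have "(UNIV :: (real ^ 'n) set) \<subseteq> closure (\<Inter>((\<lambda>(j, k). {\<theta>. phasor \<theta> j \<noteq> phasor \<theta> k}) ` {(j, k). j \<noteq> k}))"
    by (rule Baire) (auto simp: closure_phasor_neq open_phasor_neq)
  then show ?thesis
    unfolding distinct_phasors_eq by auto
qed

section \<open>Eigenfunctions and constants of motion of the partitioned model\<close>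

context partitioned_kuramoto
begin

text \<open>Weighting row \<open>j\<close> by \<open>\<mu> \<tau> j\<close> cancels the denominator
  of \<open>W\<close> and leaves the interaction \<open>g j k\<close>. It is antisymmetric, since
  \<open>S\<close> is symmetric, \<open>\<kappa>\<close> antisymmetric and the sine odd. Its double
  sum over the block therefore vanishes, and only the frequencies remain.\<close>

lemma mu_vec_inner_field:
  assumes \<tau>: "\<tau> \<in> {1..m}"
  shows "mu_vec \<M> \<mu> \<tau> \<bullet> kuramoto_field W \<alpha> \<omega> \<theta> = mu_vec \<M> \<mu> \<tau> \<bullet> \<omega>"
proof -
  let ?M = "\<M> \<tau>"
  define g where "g j k = S j k * sin (\<theta> $ k - \<theta> $ j - \<kappa> j k)" for j k
  have inner: "mu_vec \<M> \<mu> \<tau> \<bullet> x = (\<Sum>j\<in>?M. \<mu> \<tau> j * x $ j)" for x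
    by (simp add: mu_vec_def inner_vec_def if_distrib[of "\<lambda>x. x * _"] flip: sum.inter_restrict cong: if_cong)
  have row: "\<mu> \<tau> j * kuramoto_field W \<alpha> \<omega> \<theta> $ j = \<mu> \<tau> j * \<omega> $ j + (\<Sum>k\<in>?M. g j k)"
    if j: "j \<in> ?M" for j
  proof -
    have "(\<Sum>k\<in>UNIV. W $ j $ k * sin (\<theta> $ k - \<theta> $ j - \<alpha> $ j $ k))
        = (\<Sum>k\<in>?M. W $ j $ k * sin (\<theta> $ k - \<theta> $ j - \<alpha> $ j $ k))"
      by (rule sum.mono_neutral_right) (auto simp: W_M_out[OF \<tau> j])
    also have "\<mu> \<tau> j * \<dots> = (\<Sum>k\<in>?M. g j k)"
      unfolding sum_distrib_left
      by (rule sum.cong) (auto simp: g_def W_M[OF \<tau> j] alpha_M[OF \<tau> j] mu_nonzero[OF \<tau> j])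
    finally show ?thesis
      by (simp add: kuramoto_field_def distrib_left)
  qed
  have "g j k = - g k j" if "j \<in> ?M" "k \<in> ?M" for j k
  proof -
    have "\<theta> $ k - \<theta> $ j - \<kappa> j k = - (\<theta> $ j - \<theta> $ k - \<kappa> k j)"
      using kappa_antisym[OF \<tau> that] by simp
    then show ?thesis
      unfolding g_def using S_sym[OF \<tau> that] by (simp only: sin_minus)
  qed
  then have "(\<Sum>j\<in>?M. \<Sum>k\<in>?M. g j k) = (\<Sum>j\<in>?M. \<Sum>k\<in>?M. - g k j)"
    by (intro sum.cong refl)
  then have "(\<Sum>j\<in>?M. \<Sum>k\<in>?M. g j k) = - (\<Sum>j\<in>?M. \<Sum>k\<in>?M. g k j)"
    by (simp only: sum_negf)
  moreover have "(\<Sum>j\<in>?M. \<Sum>k\<in>?M. g k j) = (\<Sum>j\<in>?M. \<Sum>k\<in>?M. g j k)"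
    by (rule sum.swap)
  ultimately have "(\<Sum>j\<in>?M. \<Sum>k\<in>?M. g j k) = 0"
    by simp
  then show ?thesis
    by (simp add: inner row sum.distrib)
qed

lemma monomial_eigenfunction:
  assumes "\<tau> \<in> {1..m}"
  shows "koopman_eigenfunction (kuramoto_field W \<alpha> \<omega>)
    (\<i> * complex_of_real (mu_vec \<M> \<mu> \<tau> \<bullet> \<omega>)) (monomial (mu_vec \<M> \<mu> \<tau>))"
  by (simp add: koopman_eigenfunction_def monomial_nonzero monomial_differentiable koopman_monomial
      mu_vec_inner_field[OF assms])

text \<open>The condition on \<open>\<omega>\<close> supplies the missing self-interaction:
  \<open>2 * Im (common_coeff C ph \<gamma> j)\<close> equals
  \<open>C j \<gamma> * sin (- ph j \<gamma>)\<close>, the summand for \<open>k = j\<close>. Once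
  the sum runs over all vertices, the right-hand side depends on \<open>j\<close> only through
  \<open>\<theta> $ j\<close>.\<close>

lemma field_C:
  assumes \<gamma>: "\<gamma> \<in> {1..c}" and j: "j \<in> \<C> \<gamma>"
  shows "kuramoto_field W \<alpha> \<omega> \<theta> $ j =
    \<omega> $ ell \<gamma> + C (ell \<gamma>) \<gamma> * sin (ph (ell \<gamma>) \<gamma>) + (\<Sum>k\<in>UNIV. C k \<gamma> * sin (\<theta> $ k - \<theta> $ j - ph k \<gamma>))"
proof -
  have Im: "2 * Im (common_coeff C ph \<gamma> k) = - C k \<gamma> * sin (ph k \<gamma>)" for k
    by (simp add: common_coeff_def Im_exp)
  have "(\<Sum>k\<in>UNIV. W $ j $ k * sin (\<theta> $ k - \<theta> $ j - \<alpha> $ j $ k))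
      = (\<Sum>k\<in>UNIV - {j}. C k \<gamma> * sin (\<theta> $ k - \<theta> $ j - ph k \<gamma>))"
    by (rule sum.mono_neutral_cong_right) (auto simp: W_diag W_C[OF \<gamma> j] alpha_C[OF \<gamma> j])
  then show ?thesis
    using Im[of j] Im[of "ell \<gamma>"] omega_C[OF \<gamma> j]
    by (simp add: kuramoto_field_def sum.remove[of UNIV j])
qed

text \<open>The full sum is \<open>Im (H * cis (- \<theta> $ j))\<close> with a field
  \<open>H\<close> common to the block. Writing \<open>\<i> * Im w\<close> as
  \<open>(w - cnj w) / 2\<close> and multiplying by the phasor gives a quadratic polynomial in it.
  The coefficients may vary with \<open>\<theta>\<close> but not with \<open>j\<close>, which
  suffices because the generator acts pointwise.\<close>

lemma phasor_Riccati:
  assumes \<gamma>: "\<gamma> \<in> {1..c}"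
  obtains p q r where "\<And>j. j \<in> \<C> \<gamma> \<Longrightarrow>
    \<i> * complex_of_real (kuramoto_field W \<alpha> \<omega> \<theta> $ j) * phasor \<theta> j = p + q * phasor \<theta> j + r * (phasor \<theta> j)\<^sup>2"
proof -
  \<comment> \<open>\<open>H / 2\<close> is the sum of
    \<open>common_coeff C ph \<gamma> k * phasor \<theta> k\<close> over all vertices
    \<open>k\<close>.\<close>
  define H where "H = (\<Sum>k\<in>UNIV. complex_of_real (C k \<gamma>) * cis (\<theta> $ k - ph k \<gamma>))"
  define \<Omega> where "\<Omega> = \<omega> $ ell \<gamma> + C (ell \<gamma>) \<gamma> * sin (ph (ell \<gamma>) \<gamma>)"
  show thesis
  proof (rule that[of "H / 2" "\<i> * complex_of_real \<Omega>" "- cnj H / 2"])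
    fix j assume j: "j \<in> \<C> \<gamma>"
    have z: "phasor \<theta> j = cis (\<theta> $ j)"
      by (simp add: phasor_def cis_conv_exp)
    have "(\<Sum>k\<in>UNIV. C k \<gamma> * sin (\<theta> $ k - \<theta> $ j - ph k \<gamma>)) = Im (H * cis (- \<theta> $ j))"
      unfolding H_def sum_distrib_right Im_sum
      by (rule sum.cong) (simp_all add: mult.assoc cis_mult algebra_simps)
    then have F: "kuramoto_field W \<alpha> \<omega> \<theta> $ j = \<Omega> + Im (H * cis (- \<theta> $ j))"
      by (simp add: field_C[OF \<gamma> j] \<Omega>_def)
    have "\<i> * complex_of_real (Im (H * cis (- \<theta> $ j))) = (H * cis (- \<theta> $ j) - cnj H * cis (\<theta> $ j)) / 2"
      by (simp add: complex_eq_iff)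
    then have "\<i> * complex_of_real (kuramoto_field W \<alpha> \<omega> \<theta> $ j) * cis (\<theta> $ j) =
        (\<i> * complex_of_real \<Omega> + (H * cis (- \<theta> $ j) - cnj H * cis (\<theta> $ j)) / 2) * cis (\<theta> $ j)"
      by (simp add: F distrib_left)
    also have "\<dots> = \<i> * complex_of_real \<Omega> * cis (\<theta> $ j) +
        (H * (cis (- \<theta> $ j) * cis (\<theta> $ j)) - cnj H * (cis (\<theta> $ j))\<^sup>2) / 2"
      by (simp add: algebra_simps power2_eq_square diff_divide_distrib)
    also have "cis (- \<theta> $ j) * cis (\<theta> $ j) = 1"
      by (simp add: cis_mult)
    finally show "\<i> * complex_of_real (kuramoto_field W \<alpha> \<omega> \<theta> $ j) * phasor \<theta> j =
        H / 2 + \<i> * complex_of_real \<Omega> * phasor \<theta> j + - cnj H / 2 * (phasor \<theta> j)\<^sup>2"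
      by (simp add: z diff_divide_distrib)
  qed
qed

lemma cross_ratio_constant_of_motion:
  assumes \<gamma>: "\<gamma> \<in> {1..c}" and "{a, b, c', d} \<subseteq> \<C> \<gamma>"
  shows "constant_of_motion (kuramoto_field W \<alpha> \<omega>) (cross_ratio_domain a b c' d) (cross_ratio a b c' d)"
  unfolding constant_of_motion_def
proof (intro conjI ballI open_cross_ratio_domain)
  fix \<theta> :: "real ^ 'n"
  assume dom: "\<theta> \<in> cross_ratio_domain a b c' d"
  then show "cross_ratio a b c' d differentiable (at \<theta>)"
    by (rule cross_ratio_differentiable)
  obtain p q r where "\<And>j. j \<in> \<C> \<gamma> \<Longrightarrow>
      \<i> * complex_of_real (kuramoto_field W \<alpha> \<omega> \<theta> $ j) * phasor \<theta> j = p + q * phasor \<theta> j + r * (phasor \<theta> j)\<^sup>2"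
    using phasor_Riccati[OF \<gamma>] by blast
  then show "koopman (kuramoto_field W \<alpha> \<omega>) (cross_ratio a b c' d) \<theta> = 0"
    using koopman_cross_ratio_Riccati[OF dom] assms(2) by (metis subsetD)
qed

text \<open>
  The block \<open>\<tau>\<^sub>0\<close> is one with a nonzero eigenvalue. If there is none then \<open>\<tau>\<^sub>0\<close> is arbitrary, and
  \<open>x / 0 = 0\<close> makes the formula for \<open>\<nu>\<close> in the proof give \<open>\<mu>\<^sub>\<tau>\<close> itself.
\<close>

lemma monomial_constants_of_motion:
  obtains \<tau>\<^sub>0 \<nu> where "\<tau>\<^sub>0 \<in> {1..m}"
    and "\<And>\<tau>. \<tau> \<in> {1..m} \<Longrightarrow> constant_of_motion (kuramoto_field W \<alpha> \<omega>) UNIV (monomial (\<nu> \<tau>))"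
    and "\<And>\<tau> j. \<tau> \<in> {1..m} - {\<tau>\<^sub>0} \<Longrightarrow> j \<in> \<M> \<tau> \<Longrightarrow> \<nu> \<tau> $ j \<noteq> 0"
    and "\<And>\<tau> j. j \<notin> \<M> \<tau> \<union> \<M> \<tau>\<^sub>0 \<Longrightarrow> \<nu> \<tau> $ j = 0"
proof -
  define \<sigma> where "\<sigma> \<tau> = mu_vec \<M> \<mu> \<tau> \<bullet> \<omega>" for \<tau>
  obtain \<tau>\<^sub>0 where \<tau>\<^sub>0: "\<tau>\<^sub>0 \<in> {1..m}" and or: "\<sigma> \<tau>\<^sub>0 \<noteq> 0 \<or> (\<forall>\<tau>\<in>{1..m}. \<sigma> \<tau> = 0)"
    using m_pos by (metis atLeastAtMost_iff order_refl)
  define \<nu> where "\<nu> \<tau> = mu_vec \<M> \<mu> \<tau> - (\<sigma> \<tau> / \<sigma> \<tau>\<^sub>0) *\<^sub>R mu_vec \<M> \<mu> \<tau>\<^sub>0" for \<tau>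
  show thesis
  proof (rule that[of \<tau>\<^sub>0 \<nu>, OF \<tau>\<^sub>0])
    fix \<tau> assume \<tau>: "\<tau> \<in> {1..m}"
    have "\<nu> \<tau> \<bullet> kuramoto_field W \<alpha> \<omega> \<theta> = 0" for \<theta>
      using or \<tau> by (auto simp: \<nu>_def inner_diff_left mu_vec_inner_field[OF \<tau>] mu_vec_inner_field[OF \<tau>\<^sub>0]
          \<sigma>_def[symmetric])
    then show "constant_of_motion (kuramoto_field W \<alpha> \<omega>) UNIV (monomial (\<nu> \<tau>))"
      by (simp add: constant_of_motion_def monomial_differentiable koopman_monomial)
  next
    fix \<tau> j assume \<tau>: "\<tau> \<in> {1..m} - {\<tau>\<^sub>0}" and j: "j \<in> \<M> \<tau>"
    then have "j \<notin> \<M> \<tau>\<^sub>0"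
      using disjoint_family_onD[OF M_disjoint, of \<tau> \<tau>\<^sub>0] \<tau>\<^sub>0 by blast
    then show "\<nu> \<tau> $ j \<noteq> 0"
      using \<tau> j mu_nonzero by (simp add: \<nu>_def mu_vec_def)
  qed (simp add: \<nu>_def mu_vec_def)
qed

text \<open>The constants of motion are indexed by their private vertices: \<open>g v\<close> is the
  function, \<open>E v\<close> its domain. The last two conclusions say that the Jacobian on these
  vertices is diagonal with nonzero entries, as \<open>functionally_independent_diagonal\<close>
  requires.\<close>

lemma independent_constants_of_motion:
  obtains R :: "'n set" and K :: "nat \<Rightarrow> 'n set" and g E
  where "R \<subseteq> (\<Union>\<tau>\<in>{1..m}. \<M> \<tau>)" "card R = m - 1"
    and "\<And>\<gamma>. \<gamma> \<in> {1..c} \<Longrightarrow> K \<gamma> \<subseteq> \<C> \<gamma> \<and> card (K \<gamma>) = card (\<C> \<gamma>) - 3"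
    and "\<And>v. v \<in> R \<Longrightarrow> \<exists>\<nu> :: real ^ 'n. (\<forall>j. j \<notin> (\<Union>\<tau>\<in>{1..m}. \<M> \<tau>) \<longrightarrow> \<nu> $ j = 0) \<and>
      E v = UNIV \<and> g v = monomial \<nu>"
    and "\<And>\<gamma> v. \<gamma> \<in> {1..c} \<Longrightarrow> v \<in> K \<gamma> \<Longrightarrow>
      \<exists>a\<in>\<C> \<gamma>. \<exists>b\<in>\<C> \<gamma>. \<exists>c'\<in>\<C> \<gamma>. \<exists>d\<in>\<C> \<gamma>. distinct [a, b, c', d] \<and>
        E v = cross_ratio_domain a b c' d \<and> g v = cross_ratio a b c' d"
    and "\<And>v. v \<in> R \<union> (\<Union>\<gamma>\<in>{1..c}. K \<gamma>) \<Longrightarrow> constant_of_motion (kuramoto_field W \<alpha> \<omega>) (E v) (g v)"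
    and "\<And>v. v \<in> R \<union> (\<Union>\<gamma>\<in>{1..c}. K \<gamma>) \<Longrightarrow> distinct_phasors \<subseteq> E v"
    and "\<And>v \<theta>. v \<in> R \<union> (\<Union>\<gamma>\<in>{1..c}. K \<gamma>) \<Longrightarrow> \<theta> \<in> distinct_phasors \<Longrightarrow> partial_deriv v (g v) \<theta> \<noteq> 0"
    and "\<And>v w \<theta>. v \<in> R \<union> (\<Union>\<gamma>\<in>{1..c}. K \<gamma>) \<Longrightarrow> w \<in> R \<union> (\<Union>\<gamma>\<in>{1..c}. K \<gamma>) \<Longrightarrow> v \<noteq> w \<Longrightarrow>
      \<theta> \<in> distinct_phasors \<Longrightarrow> partial_deriv v (g w) \<theta> = 0"
proof -
  obtain \<tau>\<^sub>0 \<nu> where \<tau>\<^sub>0: "\<tau>\<^sub>0 \<in> {1..m}"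
    and \<nu>_const: "\<And>\<tau>. \<tau> \<in> {1..m} \<Longrightarrow> constant_of_motion (kuramoto_field W \<alpha> \<omega>) UNIV (monomial (\<nu> \<tau>))"
    and \<nu>_nz: "\<And>\<tau> j. \<tau> \<in> {1..m} - {\<tau>\<^sub>0} \<Longrightarrow> j \<in> \<M> \<tau> \<Longrightarrow> \<nu> \<tau> $ j \<noteq> 0"
    and \<nu>_supp: "\<And>\<tau> j. j \<notin> \<M> \<tau> \<union> \<M> \<tau>\<^sub>0 \<Longrightarrow> \<nu> \<tau> $ j = 0"
    using monomial_constants_of_motion by blast
  have M_eq: "\<tau> = \<tau>'" if "v \<in> \<M> \<tau>" "v \<in> \<M> \<tau>'" "\<tau> \<in> {1..m}" "\<tau>' \<in> {1..m}" for v \<tau> \<tau>'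
    using disjoint_family_onD[OF M_disjoint that(3,4)] that(1,2) by blast
  have C_eq: "\<gamma> = \<gamma>'" if "v \<in> \<C> \<gamma>" "v \<in> \<C> \<gamma>'" "\<gamma> \<in> {1..c}" "\<gamma>' \<in> {1..c}" for v \<gamma> \<gamma>'
    using disjoint_family_onD[OF C_disjoint that(3,4)] that(1,2) by blast
  have "\<forall>\<tau>\<in>{1..m}. \<exists>v. v \<in> \<M> \<tau>"
    using M_nonempty by blast
  then obtain \<rho> where \<rho>: "\<And>\<tau>. \<tau> \<in> {1..m} \<Longrightarrow> \<rho> \<tau> \<in> \<M> \<tau>"
    by (metis bchoice)
  have "\<forall>\<gamma>\<in>{1..c}. \<exists>x. case x of (a, b, c') \<Rightarrow> {a, b, c'} \<subseteq> \<C> \<gamma> \<and> distinct [a, b, c']"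
  proof
    fix \<gamma> assume "\<gamma> \<in> {1..c}"
    then have "3 \<le> card (\<C> \<gamma>)"
      using C_card by force
    then obtain T where "T \<subseteq> \<C> \<gamma>" "card T = 3"
      by (meson obtain_subset_with_card_n)
    then obtain a b c' where "{a, b, c'} \<subseteq> \<C> \<gamma>" "distinct [a, b, c']"
      by (auto simp: card_3_iff)
    then show "\<exists>x. case x of (a, b, c') \<Rightarrow> {a, b, c'} \<subseteq> \<C> \<gamma> \<and> distinct [a, b, c']"
      by (intro exI[of _ "(a, b, c')"]) simp
  qed
  from bchoice[OF this] obtain B where B: "\<forall>\<gamma>\<in>{1..c}.
      case B \<gamma> of (a, b, c') \<Rightarrow> {a, b, c'} \<subseteq> \<C> \<gamma> \<and> distinct [a, b, c']"
    by (rule exE)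
  define b1 b2 b3 where "b1 \<gamma> = fst (B \<gamma>)" and "b2 \<gamma> = fst (snd (B \<gamma>))" and "b3 \<gamma> = snd (snd (B \<gamma>))" for \<gamma>
  have b: "{b1 \<gamma>, b2 \<gamma>, b3 \<gamma>} \<subseteq> \<C> \<gamma>" "distinct [b1 \<gamma>, b2 \<gamma>, b3 \<gamma>]" if "\<gamma> \<in> {1..c}" for \<gamma>
    using bspec[OF B that] by (auto simp: b1_def b2_def b3_def split: prod.splits)
  \<comment> \<open>The block of \<open>\<tau>\<^sub>0\<close> gets no representative: every
    \<open>\<nu> \<tau>\<close> may have support there, so none of its vertices need be private to
    one monomial.\<close>
  define R where "R = \<rho> ` ({1..m} - {\<tau>\<^sub>0})"
  define K where "K \<gamma> = \<C> \<gamma> - {b1 \<gamma>, b2 \<gamma>, b3 \<gamma>}" for \<gamma>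
  define T where "T = R \<union> (\<Union>\<gamma>\<in>{1..c}. K \<gamma>)"
  have R_sub: "R \<subseteq> (\<Union>\<tau>\<in>{1..m}. \<M> \<tau>)"
    using \<rho> by (auto simp: R_def)
  have "inj_on \<rho> {1..m}"
    using M_eq \<rho> by (metis inj_onI)
  then have "inj_on \<rho> ({1..m} - {\<tau>\<^sub>0})"
    by (rule inj_on_subset) blast
  then have card_R: "card R = m - 1"
    unfolding R_def using \<tau>\<^sub>0 by (simp add: card_image)
  have card_K: "card (K \<gamma>) = card (\<C> \<gamma>) - 3" if "\<gamma> \<in> {1..c}" for \<gamma>
    unfolding K_def using b[OF that] by (subst card_Diff_subset) auto
  \<comment> \<open>No base point is a private vertex, so a cross-ratio over the base points of its
    block involves exactly one vertex of \<open>T\<close>.\<close>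
  have b_notin: "v \<noteq> b1 \<gamma> \<and> v \<noteq> b2 \<gamma> \<and> v \<noteq> b3 \<gamma>" if "v \<in> T" "\<gamma> \<in> {1..c}" for v \<gamma>
  proof (cases "v \<in> R")
    case True
    then have "v \<notin> \<C> \<gamma>"
      using R_sub MC_disjoint that(2) by blast
    then show ?thesis
      using b[OF that(2)] by auto
  next
    case False
    then obtain \<gamma>' where "\<gamma>' \<in> {1..c}" "v \<in> K \<gamma>'"
      using \<open>v \<in> T\<close> by (auto simp: T_def)
    then show ?thesis
      using C_eq[of v \<gamma> \<gamma>'] that(2) b[OF that(2)] by (auto simp: K_def)
  qed
  \<comment> \<open>All requirements on a function and its domain are gathered in one predicate, so
    that a single choice over \<open>T\<close> yields both together.\<close>
  let ?good = "\<lambda>v g E.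
    (v \<in> R \<longrightarrow> (\<exists>\<nu> :: real ^ 'n. (\<forall>j. j \<notin> (\<Union>\<tau>\<in>{1..m}. \<M> \<tau>) \<longrightarrow> \<nu> $ j = 0) \<and>
      E = UNIV \<and> g = monomial \<nu>)) \<and>
    (\<forall>\<gamma>\<in>{1..c}. v \<in> K \<gamma> \<longrightarrow>
      (\<exists>a\<in>\<C> \<gamma>. \<exists>b\<in>\<C> \<gamma>. \<exists>c'\<in>\<C> \<gamma>. \<exists>d\<in>\<C> \<gamma>. distinct [a, b, c', d] \<and>
        E = cross_ratio_domain a b c' d \<and> g = cross_ratio a b c' d)) \<and>
    constant_of_motion (kuramoto_field W \<alpha> \<omega>) E g \<and> distinct_phasors \<subseteq> E \<and>
    (\<forall>\<theta>\<in>distinct_phasors. partial_deriv v g \<theta> \<noteq> 0) \<and>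
    (\<forall>w\<in>T - {v}. \<forall>\<theta>\<in>distinct_phasors. partial_deriv w g \<theta> = 0)"
  have "\<forall>v\<in>T. \<exists>x. ?good v (fst x) (snd x)"
  proof
    fix v assume v: "v \<in> T"
    show "\<exists>x. ?good v (fst x) (snd x)"
    proof (cases "v \<in> R")
      case True
      then obtain \<tau> where \<tau>: "\<tau> \<in> {1..m} - {\<tau>\<^sub>0}" and v_eq: "v = \<rho> \<tau>"
        unfolding R_def by blast
      have "v \<in> \<M> \<tau>"
        using \<tau> \<rho> v_eq by blast
      \<comment> \<open>The support of \<open>\<nu> \<tau>\<close> lies in two blocks. A vertex of
        \<open>T\<close> in either one must be the representative of that block;
        \<open>\<tau>\<^sub>0\<close> has none, and that of \<open>\<tau>\<close> is
        \<open>v\<close>.\<close>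
      have "\<nu> \<tau> $ w = 0" if w: "w \<in> T" "w \<noteq> v" for w
      proof -
        have "w \<notin> \<M> \<tau>'" if \<tau>': "\<tau>' \<in> {\<tau>, \<tau>\<^sub>0}" for \<tau>'
        proof
          assume w\<tau>': "w \<in> \<M> \<tau>'"
          have m\<tau>': "\<tau>' \<in> {1..m}"
            using \<tau>' \<tau> \<tau>\<^sub>0 by auto
          then have "\<forall>\<gamma>\<in>{1..c}. w \<notin> K \<gamma>"
            using w\<tau>' MC_disjoint unfolding K_def by blast
          then obtain \<tau>'' where \<tau>'': "\<tau>'' \<in> {1..m} - {\<tau>\<^sub>0}" "w = \<rho> \<tau>''"
            using w unfolding T_def R_def by blast
          then have "\<tau>'' = \<tau>'"
            using M_eq[OF _ w\<tau>'] m\<tau>' \<rho> by blast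
          then show False
            using \<tau>'' \<tau>' w v_eq by auto
        qed
        then show ?thesis
          using \<nu>_supp by blast
      qed
      moreover have "\<forall>\<gamma>\<in>{1..c}. v \<notin> K \<gamma>"
        using \<open>v \<in> \<M> \<tau>\<close> \<tau> MC_disjoint unfolding K_def by blast
      moreover have "\<forall>j. j \<notin> (\<Union>\<tau>\<in>{1..m}. \<M> \<tau>) \<longrightarrow> \<nu> \<tau> $ j = 0"
        using \<nu>_supp \<tau> \<tau>\<^sub>0 by blast
      ultimately have "?good v (monomial (\<nu> \<tau>)) UNIV"
        using \<nu>_const[of \<tau>] \<nu>_nz[OF \<tau> \<open>v \<in> \<M> \<tau>\<close>] \<tau>
        by (auto simp: partial_deriv_monomial monomial_nonzero)
      then show ?thesis
        by (intro exI[of _ "(monomial (\<nu> \<tau>), UNIV)"]) simp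
    next
      case False
      then obtain \<gamma> where \<gamma>: "\<gamma> \<in> {1..c}" "v \<in> K \<gamma>"
        using v by (auto simp: T_def)
      let ?g = "cross_ratio (b1 \<gamma>) (b2 \<gamma>) (b3 \<gamma>) v"
        and ?E = "cross_ratio_domain (b1 \<gamma>) (b2 \<gamma>) (b3 \<gamma>) v"
      have dist: "distinct [b1 \<gamma>, b2 \<gamma>, b3 \<gamma>, v]" and sub: "{b1 \<gamma>, b2 \<gamma>, b3 \<gamma>, v} \<subseteq> \<C> \<gamma>"
        using b[OF \<gamma>(1)] \<gamma>(2) by (auto simp: K_def)
      note dom = distinct_phasors_subset_cross_ratio_domain[OF dist]
      have "partial_deriv w ?g \<theta> = 0" if "w \<in> T - {v}" "\<theta> \<in> distinct_phasors" for w \<theta>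
        using that dom b_notin[of w \<gamma>] \<gamma>(1) by (intro partial_deriv_cross_ratio_other) auto
      moreover have "partial_deriv v ?g \<theta> \<noteq> 0" if "\<theta> \<in> distinct_phasors" for \<theta>
        using partial_deriv_cross_ratio_last[OF that dist] .
      moreover have "\<exists>a\<in>\<C> \<gamma>'. \<exists>b\<in>\<C> \<gamma>'. \<exists>c'\<in>\<C> \<gamma>'. \<exists>d\<in>\<C> \<gamma>'. distinct [a, b, c', d] \<and>
          ?E = cross_ratio_domain a b c' d \<and> ?g = cross_ratio a b c' d"
        if "\<gamma>' \<in> {1..c}" "v \<in> K \<gamma>'" for \<gamma>'
      proof -
        have "\<gamma>' = \<gamma>"
          using C_eq that \<gamma> by (auto simp: K_def)
        then show ?thesis
          using dist sub by blast
      qed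
      ultimately have "?good v ?g ?E"
        using False cross_ratio_constant_of_motion[OF \<gamma>(1) sub] dom by blast
      then show ?thesis
        by (intro exI[of _ "(?g, ?E)"]) simp
    qed
  qed
  from bchoice[OF this] obtain G where G: "\<forall>v\<in>T. ?good v (fst (G v)) (snd (G v))"
    by (rule exE)
  show thesis
  proof (rule that[of R K "\<lambda>v. snd (G v)" "\<lambda>v. fst (G v)", OF R_sub card_R], goal_cases)
    case (1 \<gamma>)
    then show ?case using card_K by (auto simp: K_def)
  next
    case (2 v)
    then show ?case using bspec[OF G, of v] unfolding T_def by blast
  next
    case (3 \<gamma> v)
    then show ?case using bspec[OF G, of v] unfolding T_def by blast
  next
    case (4 v)
    then show ?case using bspec[OF G, of v] unfolding T_def by blast
  next
    case (5 v)
    then show ?case using bspec[OF G, of v] unfolding T_def by blast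
  next
    case (6 v \<theta>)
    then show ?case using bspec[OF G, of v] unfolding T_def by blast
  next
    case (7 v w \<theta>)
    \<comment> \<open>Here the predicate is taken at \<open>w\<close>, which owns the function;
      \<open>v\<close> is the foreign coordinate.\<close>
    then show ?case using bspec[OF G, of w] unfolding T_def by blast
  qed
qed

end

section \<open>From constants indexed by vertices to a family numbered below
  \<open>q\<close>\<close>

theorem mainTheorem2:
  fixes m c :: nat
    and \<M> \<C> :: "nat \<Rightarrow> 'n::finite set"
    and \<P> :: "'n set"
    and W \<alpha> :: "real ^ 'n ^ 'n"
    and \<omega> :: "real ^ 'n"
    and \<mu> :: "nat \<Rightarrow> 'n \<Rightarrow> real"
    and S \<kappa> :: "'n \<Rightarrow> 'n \<Rightarrow> real"
    and C ph :: "'n \<Rightarrow> nat \<Rightarrow> real"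
    and ell :: "nat \<Rightarrow> 'n"
    and q :: nat
  assumes model: "partitioned_kuramoto m c \<M> \<C> \<P> W \<alpha> \<omega> \<mu> S \<kappa> C ph ell"
    and q_def: "q = (m - 1) + (\<Sum>\<gamma>=1..c. card (\<C> \<gamma>) - 3)"
  shows
    "(\<forall>\<tau>\<in>{1..m}.
        koopman_eigenfunction (kuramoto_field W \<alpha> \<omega>)
          (\<i> * complex_of_real (mu_vec \<M> \<mu> \<tau> \<bullet> \<omega>)) (monomial (mu_vec \<M> \<mu> \<tau>))) \<and>
     (\<forall>\<gamma>\<in>{1..c}. \<forall>a\<in>\<C> \<gamma>. \<forall>b\<in>\<C> \<gamma>. \<forall>c'\<in>\<C> \<gamma>. \<forall>d\<in>\<C> \<gamma>.
        distinct [a, b, c', d] \<longrightarrow>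
        constant_of_motion (kuramoto_field W \<alpha> \<omega>)
          (cross_ratio_domain a b c' d) (cross_ratio a b c' d)) \<and>
     (\<exists>(f :: nat \<Rightarrow> real ^ 'n \<Rightarrow> complex) (D :: nat \<Rightarrow> (real ^ 'n) set)
        (I :: nat set) (J :: nat \<Rightarrow> nat set).
        (\<forall>i<q. constant_of_motion (kuramoto_field W \<alpha> \<omega>) (D i) (f i)) \<and>
        functionally_independent {..<q} D f \<and>
        I \<union> (\<Union>\<gamma>\<in>{1..c}. J \<gamma>) = {..<q} \<and>
        I \<inter> (\<Union>\<gamma>\<in>{1..c}. J \<gamma>) = {} \<and>
        disjoint_family_on J {1..c} \<and>
        card I = m - 1 \<and>
        (\<forall>i\<in>I. \<exists>\<nu> :: real ^ 'n. (\<forall>j. j \<notin> (\<Union>\<tau>\<in>{1..m}. \<M> \<tau>) \<longrightarrow> \<nu> $ j = 0) \<and>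
           D i = UNIV \<and> f i = monomial \<nu>) \<and>
        (\<forall>\<gamma>\<in>{1..c}. card (J \<gamma>) = card (\<C> \<gamma>) - 3 \<and>
           (\<forall>i\<in>J \<gamma>. \<exists>a\<in>\<C> \<gamma>. \<exists>b\<in>\<C> \<gamma>. \<exists>c'\<in>\<C> \<gamma>. \<exists>d\<in>\<C> \<gamma>. distinct [a, b, c', d] \<and>
              D i = cross_ratio_domain a b c' d \<and> f i = cross_ratio a b c' d)))"
proof -
  interpret partitioned_kuramoto m c \<M> \<C> \<P> W \<alpha> \<omega> \<mu> S \<kappa> C ph ell
    by (rule model)
  let ?MM = "\<Union>\<tau>\<in>{1..m}. \<M> \<tau>"
  let ?F = "kuramoto_field W \<alpha> \<omega>"
  obtain R :: "'n set" and K :: "nat \<Rightarrow> 'n set" and g E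
    where R: "R \<subseteq> ?MM" "card R = m - 1"
    and K: "\<And>\<gamma>. \<gamma> \<in> {1..c} \<Longrightarrow> K \<gamma> \<subseteq> \<C> \<gamma> \<and> card (K \<gamma>) = card (\<C> \<gamma>) - 3"
    and mono: "\<And>v. v \<in> R \<Longrightarrow> \<exists>\<nu> :: real ^ 'n. (\<forall>j. j \<notin> ?MM \<longrightarrow> \<nu> $ j = 0) \<and>
      E v = UNIV \<and> g v = monomial \<nu>"
    and cross: "\<And>\<gamma> v. \<gamma> \<in> {1..c} \<Longrightarrow> v \<in> K \<gamma> \<Longrightarrow>
      \<exists>a\<in>\<C> \<gamma>. \<exists>b\<in>\<C> \<gamma>. \<exists>c'\<in>\<C> \<gamma>. \<exists>d\<in>\<C> \<gamma>. distinct [a, b, c', d] \<and>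
        E v = cross_ratio_domain a b c' d \<and> g v = cross_ratio a b c' d"
    and const: "\<And>v. v \<in> R \<union> (\<Union>\<gamma>\<in>{1..c}. K \<gamma>) \<Longrightarrow> constant_of_motion ?F (E v) (g v)"
    and dom: "\<And>v. v \<in> R \<union> (\<Union>\<gamma>\<in>{1..c}. K \<gamma>) \<Longrightarrow> distinct_phasors \<subseteq> E v"
    and diag: "\<And>v \<theta>. v \<in> R \<union> (\<Union>\<gamma>\<in>{1..c}. K \<gamma>) \<Longrightarrow> \<theta> \<in> distinct_phasors \<Longrightarrow>
      partial_deriv v (g v) \<theta> \<noteq> 0"
    and off: "\<And>v w \<theta>. v \<in> R \<union> (\<Union>\<gamma>\<in>{1..c}. K \<gamma>) \<Longrightarrow> w \<in> R \<union> (\<Union>\<gamma>\<in>{1..c}. K \<gamma>) \<Longrightarrow> v \<noteq> w \<Longrightarrow>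
      \<theta> \<in> distinct_phasors \<Longrightarrow> partial_deriv v (g w) \<theta> = 0"
    by (rule independent_constants_of_motion) blast
  define T where "T = R \<union> (\<Union>\<gamma>\<in>{1..c}. K \<gamma>)"
  have K_disj: "K \<gamma> \<inter> K \<gamma>' = {}" if "\<gamma> \<in> {1..c}" "\<gamma>' \<in> {1..c}" "\<gamma> \<noteq> \<gamma>'" for \<gamma> \<gamma>'
  proof -
    have "\<C> \<gamma> \<inter> \<C> \<gamma>' = {}"
      using C_disjoint that by (simp add: disjoint_family_on_def)
    then show ?thesis
      using K that by blast
  qed
  have RK_disj: "R \<inter> (\<Union>\<gamma>\<in>{1..c}. K \<gamma>) = {}"
    using R K MC_disjoint by blast
  have "card (\<Union>\<gamma>\<in>{1..c}. K \<gamma>) = (\<Sum>\<gamma>=1..c. card (K \<gamma>))"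
    by (rule card_UN_disjoint) (use K_disj in auto)
  then have "card T = q"
    using K R RK_disj by (simp add: T_def card_Un_disjoint q_def)
  \<comment> \<open>The enumeration \<open>h\<close> has two uses: it renumbers the constants of
    motion, and it assigns to each number the private coordinate for the diagonal criterion.\<close>
  then obtain h where h: "bij_betw h {..<q} T"
    using ex_bij_betw_nat_finite[of T] by (auto simp: atLeast0LessThan)
  have hT: "h i \<in> T" if "i < q" for i
    using h that by (auto simp: bij_betw_def)
  have h_inj: "h i \<noteq> h k" if "i < q" "k < q" "i \<noteq> k" for i k
    using h that by (auto simp: bij_betw_def inj_on_def)
  \<comment> \<open>The index sets \<open>?I\<close> and \<open>?J \<gamma>\<close> are preimages of
    \<open>R\<close> and \<open>K \<gamma>\<close> under \<open>h\<close>, so they inherit the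
    cardinalities.\<close>
  have card_vimage: "card {i. i < q \<and> h i \<in> X} = card X" if "X \<subseteq> T" for X
  proof -
    have "h ` {i. i < q \<and> h i \<in> X} = X"
      using h that by (auto simp: bij_betw_def)
    moreover have "inj_on h {i. i < q \<and> h i \<in> X}"
      using h by (auto simp: bij_betw_def intro: inj_on_subset)
    ultimately show ?thesis
      by (metis card_image)
  qed
  let ?f = "\<lambda>i. g (h i)" and ?D = "\<lambda>i. E (h i)"
  let ?I = "{i. i < q \<and> h i \<in> R}" and ?J = "\<lambda>\<gamma>. {i. i < q \<and> h i \<in> K \<gamma>}"
  have const_h: "\<forall>i<q. constant_of_motion ?F (?D i) (?f i)"
    using const hT by (simp add: T_def)
  have "functionally_independent {..<q} ?D ?f"
  proof (rule functionally_independent_diagonal[where U = distinct_phasors and e = h])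
    fix i \<theta> assume "i \<in> {..<q}" "\<theta> \<in> (distinct_phasors :: (real ^ 'n) set)"
    then show "?f i differentiable (at \<theta>)"
      using const_h dom[of "h i"] hT by (auto simp: constant_of_motion_def T_def)
  qed (use dom diag off hT h_inj in \<open>auto simp: T_def open_distinct_phasors closure_distinct_phasors\<close>)
  moreover have "?I \<union> (\<Union>\<gamma>\<in>{1..c}. ?J \<gamma>) = {..<q}"
    using hT by (auto simp: T_def)
  moreover have "?I \<inter> (\<Union>\<gamma>\<in>{1..c}. ?J \<gamma>) = {}"
    using RK_disj by blast
  moreover have "disjoint_family_on ?J {1..c}"
    unfolding disjoint_family_on_def using K_disj by blast
  moreover have "card ?I = m - 1"
    using card_vimage[of R] R by (simp add: T_def)
  moreover have "\<forall>i\<in>?I. \<exists>\<nu> :: real ^ 'n. (\<forall>j. j \<notin> ?MM \<longrightarrow> \<nu> $ j = 0) \<and>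
      ?D i = UNIV \<and> ?f i = monomial \<nu>"
    using mono by blast
  moreover have "\<forall>\<gamma>\<in>{1..c}. card (?J \<gamma>) = card (\<C> \<gamma>) - 3 \<and>
      (\<forall>i\<in>?J \<gamma>. \<exists>a\<in>\<C> \<gamma>. \<exists>b\<in>\<C> \<gamma>. \<exists>c'\<in>\<C> \<gamma>. \<exists>d\<in>\<C> \<gamma>. distinct [a, b, c', d] \<and>
        ?D i = cross_ratio_domain a b c' d \<and> ?f i = cross_ratio a b c' d)"
  proof (intro ballI conjI)
    fix \<gamma> assume \<gamma>: "\<gamma> \<in> {1..c}"
    then have "K \<gamma> \<subseteq> T"
      by (auto simp: T_def)
    then show "card (?J \<gamma>) = card (\<C> \<gamma>) - 3"
      using card_vimage K[OF \<gamma>] by simp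
  qed (use cross in blast)
  ultimately have part3: "\<exists>(f :: nat \<Rightarrow> real ^ 'n \<Rightarrow> complex) (D :: nat \<Rightarrow> (real ^ 'n) set)
        (I :: nat set) (J :: nat \<Rightarrow> nat set).
        (\<forall>i<q. constant_of_motion (kuramoto_field W \<alpha> \<omega>) (D i) (f i)) \<and>
        functionally_independent {..<q} D f \<and>
        I \<union> (\<Union>\<gamma>\<in>{1..c}. J \<gamma>) = {..<q} \<and>
        I \<inter> (\<Union>\<gamma>\<in>{1..c}. J \<gamma>) = {} \<and>
        disjoint_family_on J {1..c} \<and>
        card I = m - 1 \<and>
        (\<forall>i\<in>I. \<exists>\<nu> :: real ^ 'n. (\<forall>j. j \<notin> (\<Union>\<tau>\<in>{1..m}. \<M> \<tau>) \<longrightarrow> \<nu> $ j = 0) \<and>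
           D i = UNIV \<and> f i = monomial \<nu>) \<and>
        (\<forall>\<gamma>\<in>{1..c}. card (J \<gamma>) = card (\<C> \<gamma>) - 3 \<and>
           (\<forall>i\<in>J \<gamma>. \<exists>a\<in>\<C> \<gamma>. \<exists>b\<in>\<C> \<gamma>. \<exists>c'\<in>\<C> \<gamma>. \<exists>d\<in>\<C> \<gamma>. distinct [a, b, c', d] \<and>
              D i = cross_ratio_domain a b c' d \<and> f i = cross_ratio a b c' d))"
    using const_h by (intro exI[of _ ?f] exI[of _ ?D] exI[of _ ?I] exI[of _ ?J] conjI)
  show ?thesis
    using monomial_eigenfunction cross_ratio_constant_of_motion part3 by (intro conjI) auto
qed

end
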